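(* Let $k\ge 4$ and let $P\in\mathcal{P}_3(k)$ be a finite poset. Then $\gamma_{\mathrm{os}}(P)=\gamma_{\mathrm{os}}(\mathrm{Red}_3(P))$.
   Context: For a poset $P=(X,\le)$, $\mathrm{Max}(P)$ and $\mathrm{Min}(P)$ are the sets of maximal and minimal elements, and $\mathrm{Mid}(P)=X\setminus(\mathrm{Max}(P)\cup\mathrm{Min}(P))$. The height of $P$ is the maximum size (number of elements) of a chain in $P$. $\mathcal{P}_3(k)$ denotes the family of posets of height $k$ in which every element is contained in a chain of size at least $3$. The comparability graph $\mathrm{Comp}(P)$ has vertex set $X$, with $x\neq y$ adjacent iff $x<y$ or $y<x$. A dominating set of a graph is a set $S$ of vertices such that every vertex not in $S$ has a neighbor in $S$. An order-sensitive dominating set of $P$ is a dominating set $D$ of $\mathrm{Comp}(P)$ such that for every $x\in\mathrm{Mid}(P)$, either $x\in D$ or there are $a,b\in D$ with $a<x<b$. $\gamma_{\mathrm{os}}(P)$ is the minimum size of an order-sensitive dominating set of $P$. The reduction poset $\mathrm{Red}_3(P)$ of a poset $P=(X,\le)$ of height at least $4$ is the height three poset on $X$ obtained from $P$ by removing all comparabilities between distinct elements of $\mathrm{Mid}(P)$ and preserving all the remaining relations of $P$. *)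

theory Defs
  imports Main
begin

text \<open>
  A poset is a carrier \<open>X\<close> with a reflexive order relation \<open>r\<close> such that \<open>partial_order_on X r\<close>.
\<close>

definition less_in :: "'a rel \<Rightarrow> 'a \<Rightarrow> 'a \<Rightarrow> bool" where
  "less_in r x y \<longleftrightarrow> (x, y) \<in> r \<and> x \<noteq> y"

definition max_elems :: "'a set \<Rightarrow> 'a rel \<Rightarrow> 'a set" where
  "max_elems X r = {x \<in> X. \<not> (\<exists>y\<in>X. less_in r x y)}"

definition min_elems :: "'a set \<Rightarrow> 'a rel \<Rightarrow> 'a set" where
  "min_elems X r = {x \<in> X. \<not> (\<exists>y\<in>X. less_in r y x)}"

definition mid_elems :: "'a set \<Rightarrow> 'a rel \<Rightarrow> 'a set" where
  "mid_elems X r = X - (max_elems X r \<union> min_elems X r)"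

text \<open>
  Every \<open>C \<in> Chains r\<close> is a subset of \<open>X\<close> when \<open>r \<subseteq> X \<times> X\<close>. Height is a predicate rather
  than a function because the maximum need not exist in an infinite poset; the finiteness clauses
  are needed because \<open>card\<close> of an infinite set is \<open>0\<close>.
\<close>

definition has_height :: "'a rel \<Rightarrow> nat \<Rightarrow> bool" where
  "has_height r k \<longleftrightarrow>
     (\<exists>C\<in>Chains r. finite C \<and> card C = k) \<and> (\<forall>C\<in>Chains r. finite C \<and> card C \<le> k)"

definition P3 :: "nat \<Rightarrow> ('a set \<times> 'a rel) set" where
  "P3 k = {(X, r). partial_order_on X r \<and> has_height r k \<and>
                   (\<forall>x\<in>X. \<exists>C\<in>Chains r. x \<in> C \<and> card C \<ge> 3)}"

text \<open>Simple graphs are pairs of a vertex set and a set of two-element edges.\<close>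

definition Comp :: "'a set \<Rightarrow> 'a rel \<Rightarrow> 'a set \<times> 'a set set" where
  "Comp X r = (X, {{x, y} | x y. x \<in> X \<and> y \<in> X \<and> x \<noteq> y \<and> (less_in r x y \<or> less_in r y x)})"

definition dominating_set :: "'a set \<times> 'a set set \<Rightarrow> 'a set \<Rightarrow> bool" where
  "dominating_set G S \<longleftrightarrow> S \<subseteq> fst G \<and> (\<forall>v \<in> fst G - S. \<exists>u\<in>S. {u, v} \<in> snd G)"

definition os_dominating_set :: "'a set \<Rightarrow> 'a rel \<Rightarrow> 'a set \<Rightarrow> bool" where
  "os_dominating_set X r D \<longleftrightarrow>
     dominating_set (Comp X r) D \<and>
     (\<forall>x\<in>mid_elems X r. x \<in> D \<or> (\<exists>a\<in>D. \<exists>b\<in>D. less_in r a x \<and> less_in r x b))"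

definition gamma_os :: "'a set \<Rightarrow> 'a rel \<Rightarrow> nat" where
  "gamma_os X r = (LEAST n. \<exists>D. os_dominating_set X r D \<and> finite D \<and> card D = n)"

text \<open>
  The carrier itself always qualifies, so for finite \<open>X\<close> the minimum in \<open>gamma_os\<close> is attained.
\<close>

lemma os_dominating_set_carrier: "os_dominating_set X r X"
  by (auto simp: os_dominating_set_def dominating_set_def Comp_def mid_elems_def)

text \<open>The order relation of the reduction poset; its carrier is again \<open>X\<close>.\<close>

definition Red3 :: "'a set \<Rightarrow> 'a rel \<Rightarrow> 'a rel" where
  "Red3 X r = r - {(x, y). x \<in> mid_elems X r \<and> y \<in> mid_elems X r \<and> x \<noteq> y}"

lemma partial_order_on_Red3:
  assumes "partial_order_on X r"
  shows "partial_order_on X (Red3 X r)"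
proof -
  note po = partial_order_onD[OF assms]
  have "trans (Red3 X r)"
  proof (rule transI)
    fix x y z
    assume xy: "(x, y) \<in> Red3 X r" and yz: "(y, z) \<in> Red3 X r"
    have xz: "(x, z) \<in> r"
      using xy yz po(2) unfolding Red3_def by (blast dest: transD)
    have inX: "x \<in> X" "y \<in> X" "z \<in> X"
      using xy yz po(4) unfolding Red3_def by auto
    have False if m: "x \<in> mid_elems X r" "z \<in> mid_elems X r" and ne: "x \<noteq> z"
    proof (cases "x = y \<or> y = z")
      case True
      then show False using m ne xy yz unfolding Red3_def by auto
    next
      case False
      then have "less_in r x y" "less_in r y z"
        using xy yz unfolding Red3_def less_in_def by auto
      then have "y \<in> mid_elems X r"
        using inX unfolding mid_elems_def max_elems_def min_elems_def by blast
      then show False using False m xy unfolding Red3_def by auto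
    qed
    then show "(x, z) \<in> Red3 X r"
      using xz unfolding Red3_def by blast
  qed
  moreover have "refl_on X (Red3 X r)"
    using po(1) unfolding Red3_def refl_on_def by auto
  moreover have "antisym (Red3 X r)"
    using po(3) unfolding Red3_def antisym_def by auto
  moreover have "Red3 X r \<subseteq> X \<times> X"
    using po(4) unfolding Red3_def by auto
  ultimately show ?thesis
    unfolding partial_order_on_def preorder_on_def by blast
qed

end

theory Submission
  imports Defs
begin

text \<open>
  Since \<open>P\<close> and its reduction have the same extremal and middle elements, every order-sensitive
  dominating set of the reduction is one of \<open>P\<close>. Conversely, let \<open>D\<close> be an order-sensitive
  dominating set of \<open>P\<close>. Push each middle element \<open>d\<close> of \<open>D\<close> to a maximal element above it if
  some element of \<open>D\<close> lies below \<open>d\<close>; otherwise push it to a minimal element below it if some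
  element of \<open>D\<close> lies above \<open>d\<close>; otherwise keep it. This does not increase the size. If
  \<open>a < b\<close> in \<open>D\<close>, then the image contains a maximal element above \<open>b\<close>, and also a minimal
  element below \<open>a\<close> (look at a minimal element of \<open>D\<close> below \<open>a\<close>). Hence extremal elements
  of the image take over whatever comparabilities between middle elements \<open>D\<close> used.
\<close>

lemma less_in_trans:
  assumes "partial_order_on X r" "less_in r x y" "less_in r y z"
  shows "less_in r x z"
  using partial_order_onD(2,3)[OF assms(1)] assms(2,3)
  unfolding less_in_def by (metis antisymD transD)

lemma less_in_le_trans:
  assumes "partial_order_on X r" "less_in r x y" "(y, z) \<in> r"
  shows "less_in r x z"
  using less_in_trans[OF assms(1,2)] assms(2,3) unfolding less_in_def by metis

lemma le_less_in_trans:
  assumes "partial_order_on X r" "(x, y) \<in> r" "less_in r y z"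
  shows "less_in r x z"
  using less_in_trans[OF assms(1) _ assms(3)] assms(2,3) unfolding less_in_def by metis

lemma less_in_converse: "less_in (r\<inverse>) x y \<longleftrightarrow> less_in r y x"
  unfolding less_in_def by auto

text \<open>A minimal element of the finite part of \<open>A\<close> below \<open>a\<close> is
  minimal in all of \<open>A\<close>, by transitivity. With \<open>A = X\<close> this gives minimal
  elements of the poset; it is also applied to a dominating set.\<close>

lemma ex_minimal_below:
  assumes po: "partial_order_on X r" and "finite A" "A \<subseteq> X" "a \<in> A"
  shows "\<exists>m\<in>A. (m, a) \<in> r \<and> (\<forall>d\<in>A. \<not> less_in r d m)"
proof -
  let ?B = "{d \<in> A. (d, a) \<in> r}"
  have "a \<in> ?B"
    using assms partial_order_onD(1)[OF po] by (auto dest: refl_onD)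
  moreover have "asymp_on ?B (less_in r)"
    using partial_order_onD(3)[OF po]
    by (auto intro!: asymp_onI simp: less_in_def dest: antisymD)
  moreover have "transp_on ?B (less_in r)"
    using less_in_trans[OF po] by (auto intro!: transp_onI)
  moreover have "finite ?B"
    using assms by auto
  ultimately obtain m where m: "m \<in> ?B" "\<And>x. x \<in> ?B \<Longrightarrow> x \<noteq> m \<Longrightarrow> \<not> less_in r x m"
    using Finite_Set.bex_min_element[of ?B "less_in r"] by blast
  have "\<not> less_in r d m" if "d \<in> A" for d
  proof
    assume d: "less_in r d m"
    with m(1) have "less_in r d a"
      using less_in_le_trans[OF po] by blast
    with that d m(2)[of d] show False
      by (auto simp: less_in_def)
  qed
  with m(1) show ?thesis
    by blast
qed

lemma ex_min_elem_below:
  assumes "partial_order_on X r" "finite X" "x \<in> X"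
  shows "\<exists>m\<in>min_elems X r. (m, x) \<in> r"
  using ex_minimal_below[OF assms(1,2) order_refl assms(3)] unfolding min_elems_def by blast

lemma ex_max_elem_above:
  assumes "partial_order_on X r" "finite X" "x \<in> X"
  shows "\<exists>m\<in>max_elems X r. (x, m) \<in> r"
proof -
  have "partial_order_on X (r\<inverse>)"
    using assms(1) by simp
  from ex_min_elem_below[OF this assms(2,3)] show ?thesis
    unfolding min_elems_def max_elems_def less_in_converse by blast
qed

lemma less_in_Red3:
  "less_in (Red3 X r) x y \<longleftrightarrow>
     less_in r x y \<and> \<not> (x \<in> mid_elems X r \<and> y \<in> mid_elems X r)"
  unfolding Red3_def less_in_def by auto

lemma mid_elems_iff:
  "x \<in> mid_elems X r \<longleftrightarrow> x \<in> X \<and> (\<exists>y\<in>X. less_in r x y) \<and> (\<exists>y\<in>X. less_in r y x)"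
  unfolding mid_elems_def max_elems_def min_elems_def by blast

text \<open>A middle element keeps its comparabilities with a minimal element below it and a maximal
  element above it, since only pairs inside the middle are removed.\<close>

lemma mid_elems_Red3:
  assumes po: "partial_order_on X r" and fin: "finite X"
  shows "mid_elems X (Red3 X r) = mid_elems X r"
proof
  show "mid_elems X (Red3 X r) \<subseteq> mid_elems X r"
    unfolding mid_elems_iff[abs_def] less_in_Red3 subset_iff by (auto simp: mid_elems_iff)
next
  show "mid_elems X r \<subseteq> mid_elems X (Red3 X r)"
  proof
    fix x assume x: "x \<in> mid_elems X r"
    then have xX: "x \<in> X"
      by (simp add: mid_elems_iff)
    obtain a where a: "a \<in> min_elems X r" "(a, x) \<in> r"
      using ex_min_elem_below[OF po fin xX] by blast
    obtain b where b: "b \<in> max_elems X r" "(x, b) \<in> r"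
      using ex_max_elem_above[OF po fin xX] by blast
    have "less_in (Red3 X r) a x" "less_in (Red3 X r) x b"
      using a b x unfolding less_in_Red3 by (auto simp: less_in_def mid_elems_def)
    moreover have "a \<in> X" "b \<in> X"
      using a b by (auto simp: min_elems_def max_elems_def)
    ultimately show "x \<in> mid_elems X (Red3 X r)"
      using xX by (auto simp: mid_elems_iff[of x X "Red3 X r"])
  qed
qed

lemma os_dominating_set_iff:
  "os_dominating_set X r D \<longleftrightarrow>
     D \<subseteq> X \<and> (\<forall>v\<in>X - D. \<exists>u\<in>D. less_in r u v \<or> less_in r v u) \<and>
     (\<forall>x\<in>mid_elems X r - D. \<exists>a\<in>D. \<exists>b\<in>D. less_in r a x \<and> less_in r x b)"
proof -
  have "{u, v} \<in> snd (Comp X r) \<longleftrightarrow> less_in r u v \<or> less_in r v u"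
    if "u \<in> X" "v \<in> X" for u v
    using that unfolding Comp_def by (auto simp: less_in_def doubleton_eq_iff)
  moreover have "fst (Comp X r) = X"
    by (simp add: Comp_def)
  ultimately show ?thesis
    unfolding os_dominating_set_def dominating_set_def by (simp add: subset_iff) blast
qed

text \<open>Passing from the reduction back to \<open>r\<close> only adds comparabilities and leaves
  the middle unchanged, so all witnesses persist.\<close>

lemma os_dominating_set_of_Red3:
  assumes "partial_order_on X r" "finite X" "os_dominating_set X (Red3 X r) D"
  shows "os_dominating_set X r D"
  using assms(3) unfolding os_dominating_set_iff mid_elems_Red3[OF assms(1,2)] less_in_Red3
  by blast

lemma ex_os_dominating_set_Red3:
  assumes po: "partial_order_on X r" and fin: "finite X" and os: "os_dominating_set X r D"
  shows "\<exists>D'. os_dominating_set X (Red3 X r) D' \<and> card D' \<le> card D"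
proof -
  let ?Mid = "mid_elems X r" and ?Min = "min_elems X r" and ?Max = "max_elems X r"
  have DX: "D \<subseteq> X"
    and dom: "\<And>v. v \<in> X \<Longrightarrow> v \<notin> D \<Longrightarrow> \<exists>u\<in>D. less_in r u v \<or> less_in r v u"
    and btw: "\<And>x. x \<in> ?Mid \<Longrightarrow> x \<notin> D \<Longrightarrow> \<exists>a\<in>D. \<exists>b\<in>D. less_in r a x \<and> less_in r x b"
    using os unfolding os_dominating_set_iff by auto
  have finD: "finite D"
    using DX fin finite_subset by blast
  obtain lo where lo: "\<And>x. x \<in> X \<Longrightarrow> lo x \<in> ?Min \<and> (lo x, x) \<in> r"
    using ex_min_elem_below[OF po fin] by metis
  obtain hi where hi: "\<And>x. x \<in> X \<Longrightarrow> hi x \<in> ?Max \<and> (x, hi x) \<in> r"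
    using ex_max_elem_above[OF po fin] by metis
  \<comment> \<open>Extremal elements stay fixed. The order of the tests matters: a middle element
    with members of \<open>D\<close> on both sides moves up.\<close>
  define f where "f d = (if d \<notin> ?Mid then d
      else if \<exists>e\<in>D. less_in r e d then hi d
      else if \<exists>e\<in>D. less_in r d e then lo d else d)" for d
  let ?E = "f ` D"
  have upper: "\<exists>m\<in>?E. m \<in> ?Max \<and> (b, m) \<in> r" if ab: "a \<in> D" "b \<in> D" "less_in r a b" for a b
  proof -
    have "f b \<in> ?Max \<and> (b, f b) \<in> r"
    proof (cases "b \<in> ?Mid")
      case True
      then show ?thesis using ab hi DX by (auto simp: f_def)
    next
      case False
      then have "b \<in> ?Max"
        using ab DX by (auto simp: mid_elems_iff max_elems_def)
      then show ?thesis
        using False ab(2) DX partial_order_onD(1)[OF po] by (auto simp: f_def dest: refl_onD)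
    qed
    then show ?thesis
      using ab(2) by blast
  qed
  have lower: "\<exists>m\<in>?E. m \<in> ?Min \<and> (m, a) \<in> r" if ab: "a \<in> D" "b \<in> D" "less_in r a b" for a b
  proof -
    \<comment> \<open>\<open>a\<close> itself may be pushed up by \<open>f\<close>. A minimal
      \<open>d\<close> of \<open>D\<close> below it has nothing of \<open>D\<close> underneath but
      has \<open>b\<close> above, so \<open>f\<close> sends it down if it is in the middle.\<close>
    obtain d where d: "d \<in> D" "(d, a) \<in> r" "\<And>e. e \<in> D \<Longrightarrow> \<not> less_in r e d"
      using ex_minimal_below[OF po finD DX ab(1)] by blast
    have db: "less_in r d b"
      using le_less_in_trans[OF po d(2) ab(3)] .
    have "f d \<in> ?Min \<and> (f d, d) \<in> r"
    proof (cases "d \<in> ?Mid")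
      case True
      then show ?thesis using d db ab(2) lo DX by (auto simp: f_def)
    next
      case False
      then have "d \<in> ?Min"
        using d(1) ab(2) db DX by (auto simp: mid_elems_iff min_elems_def)
      then show ?thesis
        using False d(1) DX partial_order_onD(1)[OF po] by (auto simp: f_def dest: refl_onD)
    qed
    then show ?thesis
      using d(1,2) partial_order_onD(2)[OF po] by (blast dest: transD)
  qed
  have f_isolated: "f d = d" if "\<And>e. e \<in> D \<Longrightarrow> \<not> less_in r e d \<and> \<not> less_in r d e" for d
    using that by (auto simp: f_def)
  have notMid: "m \<notin> ?Mid" if "m \<in> ?Min \<or> m \<in> ?Max" for m
    using that by (auto simp: mid_elems_def)
  have EX: "?E \<subseteq> X"
    using DX lo hi by (auto simp: f_def min_elems_def max_elems_def)
  have btwE: "\<exists>a\<in>?E. \<exists>b\<in>?E. less_in (Red3 X r) a x \<and> less_in (Red3 X r) x b"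
    if x: "x \<in> ?Mid" "x \<notin> ?E" for x
  proof -
    \<comment> \<open>Weak inequalities suffice: extremal witnesses differ from the middle element
      \<open>x\<close>, and their comparabilities with it survive the reduction.\<close>
    have "(\<exists>a\<in>?E. a \<in> ?Min \<and> (a, x) \<in> r) \<and> (\<exists>b\<in>?E. b \<in> ?Max \<and> (x, b) \<in> r)"
    proof (cases "x \<in> D")
      case True
      \<comment> \<open>\<open>f\<close> must have moved \<open>x\<close>, so \<open>x\<close> has a
        neighbour in \<open>D\<close>; these two form the pair \<open>a\<close>, \<open>b\<close>,
        with \<open>x\<close> as one end.\<close>
      then have "\<exists>e\<in>D. less_in r e x \<or> less_in r x e"
        using f_isolated[of x] x(2) by (metis imageI)
      then obtain a b where ab: "a \<in> D" "b \<in> D" "less_in r a b" "(a, x) \<in> r" "(x, b) \<in> r"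
        using True DX partial_order_onD(1)[OF po] unfolding less_in_def
        by (meson refl_onD subsetD)
      then show ?thesis
        using upper[OF ab(1-3)] lower[OF ab(1-3)] partial_order_onD(2)[OF po]
        by (meson transD)
    next
      case False
      then obtain a b where ab: "a \<in> D" "b \<in> D" "less_in r a x" "less_in r x b"
        using btw x(1) by blast
      then have "less_in r a b"
        using less_in_trans[OF po] by blast
      with ab show ?thesis
        using upper[OF ab(1,2)] lower[OF ab(1,2)] partial_order_onD(2)[OF po]
        unfolding less_in_def by (meson transD)
    qed
    then show ?thesis
      using x notMid unfolding less_in_Red3 unfolding less_in_def by metis
  qed
  have "\<exists>u\<in>?E. less_in (Red3 X r) u v \<or> less_in (Red3 X r) v u" if v: "v \<in> X" "v \<notin> ?E" for v
  proof (cases "v \<in> ?Mid")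
    case True
    then show ?thesis using btwE v by blast
  next
    case False
    have "v \<notin> D"
      using False v(2) by (force simp: f_def)
    then obtain u where u: "u \<in> D" "less_in r u v \<or> less_in r v u"
      using dom v(1) by blast
    \<comment> \<open>As \<open>v\<close> is not in the middle, none of its comparabilities is
      removed, so domination in \<open>r\<close> is enough.\<close>
    have "\<exists>w\<in>?E. less_in r w v \<or> less_in r v w"
    proof (cases "\<exists>e\<in>D. less_in r e u \<or> less_in r u e")
      case True
      then obtain a b where ab: "a \<in> D" "b \<in> D" "less_in r a b" "(a, u) \<in> r" "(u, b) \<in> r"
        using u(1) DX partial_order_onD(1)[OF po] unfolding less_in_def
        by (meson refl_onD subsetD)
      \<comment> \<open>The image encloses \<open>u\<close> from both sides: \<open>m\<close>
        dominates \<open>v\<close> if \<open>v\<close> is above \<open>u\<close>, and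
        \<open>M\<close> does if \<open>v\<close> is below.\<close>
      then obtain m M where "m \<in> ?E" "(m, u) \<in> r" "M \<in> ?E" "(u, M) \<in> r"
        using upper[OF ab(1-3)] lower[OF ab(1-3)] partial_order_onD(2)[OF po]
        by (meson transD)
      then show ?thesis
        using u(2) less_in_le_trans[OF po] le_less_in_trans[OF po] by blast
    next
      case no_nbr: False
      then have "f u = u"
        using f_isolated by blast
      then show ?thesis
        using u by (metis imageI)
    qed
    then show ?thesis
      using False by (auto simp: less_in_Red3)
  qed
  then have "os_dominating_set X (Red3 X r) ?E"
    using EX btwE unfolding os_dominating_set_iff mid_elems_Red3[OF po fin] by blast
  then show ?thesis
    using card_image_le[OF finD] by blast
qed

lemma os_dominating_set_finite:
  "finite X \<Longrightarrow> os_dominating_set X r D \<Longrightarrow> finite D"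
  unfolding os_dominating_set_iff by (blast intro: finite_subset)

lemma gamma_os_le:
  assumes "finite X" "os_dominating_set X r D"
  shows "gamma_os X r \<le> card D"
  unfolding gamma_os_def using assms os_dominating_set_finite[OF assms] by (blast intro: Least_le)

lemma gamma_os_attained:
  assumes "finite X"
  shows "\<exists>D. os_dominating_set X r D \<and> card D = gamma_os X r"
proof -
  have "\<exists>n D. os_dominating_set X r D \<and> finite D \<and> card D = n"
    using assms os_dominating_set_carrier by blast
  from LeastI_ex[OF this] show ?thesis
    unfolding gamma_os_def by blast
qed

theorem proposition8:
  fixes X :: "'a set" and r :: "'a rel" and k :: nat
  assumes "k \<ge> 4"
    and "finite X"
    and "(X, r) \<in> P3 k"
  shows "gamma_os X r = gamma_os X (Red3 X r)"
proof (rule antisym)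
  have po: "partial_order_on X r"
    using assms(3) by (simp add: P3_def)
  show "gamma_os X r \<le> gamma_os X (Red3 X r)"
    using gamma_os_attained[OF assms(2)] gamma_os_le[OF assms(2)]
      os_dominating_set_of_Red3[OF po assms(2)] by metis
  show "gamma_os X (Red3 X r) \<le> gamma_os X r"
    using gamma_os_attained[OF assms(2), of r] gamma_os_le[OF assms(2)]
      ex_os_dominating_set_Red3[OF po assms(2)] by (metis order_trans)
qed

end
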